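(* For any set $\Sigma$ and any monoids $M$ and $M'$ there is an isomorphism of categories $$[M',\mathcal{K}l(\mathcal{P}^{\Sigma,M})]^{\mathsf{Set}}\cong[M'\times M,\mathcal{K}l(\mathcal{P}^{\Sigma,1})]^{\mathsf{Set}}.$$
   Context: Let $\Sigma_\tau=\Sigma+\{\tau\}$. For a monoid $(M,\cdot,1)$, $\mathcal{P}^{\Sigma,M}$ is the monad $X\mapsto\mathcal{P}(\Sigma_\tau\times M\times X)$ on $\mathsf{Set}$ with unit $\eta_X(x)=\{(\tau,1,x)\}$, whose Kleisli composition of $f:X\to\mathcal{P}(\Sigma_\tau\times M\times Y)$ and $g:Y\to\mathcal{P}(\Sigma_\tau\times M\times Z)$ is $g\circ f(x)=\{(\sigma,m\cdot n,z)\mid \exists y:\ ((\sigma,m,y)\in f(x)\wedge(\tau,n,z)\in g(y))\text{ or }((\tau,m,y)\in f(x)\wedge(\sigma,n,z)\in g(y)),\ \sigma\in\Sigma_\tau\}$. Kleisli hom-sets are ordered pointwise by inclusion: $f\leq g$ iff $f(x)\subseteq g(x)$ for all $x$. $1$ is the trivial monoid, so $\mathcal{P}^{\Sigma,1}\cong\mathcal{P}(\Sigma_\tau\times\mathcal{I}d)$. A monoid is regarded as a one-object category. For a monoid $N$ and an order enriched category $\mathsf{K}$ containing $\mathsf{Set}$ via $f\mapsto\eta\circ f$, $[N,\mathsf{K}]^{\mathsf{Set}}$ is the category whose objects are families $(\pi_n:X\to X)_{n\in N}$ of Kleisli endomorphisms of a common set $X$ with $id_X\leq\pi_1$ and $\pi_m\circ\pi_n\leq\pi_{m\cdot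 n}$ (lax functors), and whose morphisms $\pi\to\pi'$ are functions $f$ between carriers with $(\eta\circ f)\circ\pi_n\leq\pi'_n\circ(\eta\circ f)$ for all $n\in N$ (oplax transformations with components from $\mathsf{Set}$). $M'\times M$ is the product monoid.
   Formalization: Laxness is taken as π_n∘π_m ≤ π_{m·n} instead of π_m∘π_n ≤ π_{m·n}; with the printed order of Kleisli labels the claim fails for some noncommutative M, M' (e.g. Σ empty, M=M'={1,a,b} with xy=x for x,y in {a,b}). *)

theory Defs
  imports "HOL-Algebra.Group" "HOL-Algebra.Elementary_Groups" "HOL-Library.FuncSet"
begin

section \<open>Categories and isomorphism of categories\<close>

text \<open>
  Hom-sets of different pairs of objects need not be disjoint; therefore composition and the
  arrow part of a functor carry the objects involved as arguments:
  \<open>Comp C X Y Z g f\<close> is \<open>g \<circ> f\<close> for \<open>f : X \<rightarrow> Y\<close> and \<open>g : Y \<rightarrow> Z\<close>.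
\<close>

record ('o, 'f) category =
  Obj :: "'o set"
  Hom :: "'o \<Rightarrow> 'o \<Rightarrow> 'f set"
  Ident :: "'o \<Rightarrow> 'f"
  Comp :: "'o \<Rightarrow> 'o \<Rightarrow> 'o \<Rightarrow> 'f \<Rightarrow> 'f \<Rightarrow> 'f"

locale category =
  fixes C :: "('o, 'f, 'z) category_scheme"
  assumes Ident_in: "X \<in> Obj C \<Longrightarrow> Ident C X \<in> Hom C X X"
    and Comp_in: "\<lbrakk>X \<in> Obj C; Y \<in> Obj C; Z \<in> Obj C; f \<in> Hom C X Y; g \<in> Hom C Y Z\<rbrakk>
      \<Longrightarrow> Comp C X Y Z g f \<in> Hom C X Z"
    and Comp_Ident_right: "\<lbrakk>X \<in> Obj C; Y \<in> Obj C; f \<in> Hom C X Y\<rbrakk>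
      \<Longrightarrow> Comp C X X Y f (Ident C X) = f"
    and Comp_Ident_left: "\<lbrakk>X \<in> Obj C; Y \<in> Obj C; f \<in> Hom C X Y\<rbrakk>
      \<Longrightarrow> Comp C X Y Y (Ident C Y) f = f"
    and Comp_assoc: "\<lbrakk>W \<in> Obj C; X \<in> Obj C; Y \<in> Obj C; Z \<in> Obj C;
        f \<in> Hom C W X; g \<in> Hom C X Y; h \<in> Hom C Y Z\<rbrakk>
      \<Longrightarrow> Comp C W Y Z h (Comp C W X Y g f) = Comp C W X Z (Comp C X Y Z h g) f"

locale category_functor = C: category C + D: category D
  for C :: "('o1, 'f1, 'z1) category_scheme"
    and D :: "('o2, 'f2, 'z2) category_scheme" +
  fixes Fo :: "'o1 \<Rightarrow> 'o2"
    and Fa :: "'o1 \<Rightarrow> 'o1 \<Rightarrow> 'f1 \<Rightarrow> 'f2"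
  assumes Fo_in: "X \<in> Obj C \<Longrightarrow> Fo X \<in> Obj D"
    and Fa_in: "\<lbrakk>X \<in> Obj C; Y \<in> Obj C; f \<in> Hom C X Y\<rbrakk>
      \<Longrightarrow> Fa X Y f \<in> Hom D (Fo X) (Fo Y)"
    and Fa_Ident: "X \<in> Obj C \<Longrightarrow> Fa X X (Ident C X) = Ident D (Fo X)"
    and Fa_Comp: "\<lbrakk>X \<in> Obj C; Y \<in> Obj C; Z \<in> Obj C; f \<in> Hom C X Y; g \<in> Hom C Y Z\<rbrakk>
      \<Longrightarrow> Fa X Z (Comp C X Y Z g f) = Comp D (Fo X) (Fo Y) (Fo Z) (Fa Y Z g) (Fa X Y f)"

definition isomorphic_categories ::
  "('o1, 'f1, 'z1) category_scheme \<Rightarrow> ('o2, 'f2, 'z2) category_scheme \<Rightarrow> bool"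
  (infix "\<cong>\<^sub>C" 50) where
  "C \<cong>\<^sub>C D \<longleftrightarrow> (\<exists>Fo Fa Go Ga.
     category_functor C D Fo Fa \<and> category_functor D C Go Ga \<and>
     (\<forall>X\<in>Obj C. Go (Fo X) = X) \<and>
     (\<forall>X\<in>Obj D. Fo (Go X) = X) \<and>
     (\<forall>X\<in>Obj C. \<forall>Y\<in>Obj C. \<forall>f\<in>Hom C X Y. Ga (Fo X) (Fo Y) (Fa X Y f) = f) \<and>
     (\<forall>X\<in>Obj D. \<forall>Y\<in>Obj D. \<forall>f\<in>Hom D X Y. Fa (Go X) (Go Y) (Ga X Y f) = f))"

section \<open>Order enriched categories containing Set\<close>

text \<open>
  The category of sets is taken relative to an arbitrary type \<open>'x\<close> as universe: its objects are
  all sets of type \<open>'x set\<close>, its arrows are functions made extensional outside their domain.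
\<close>

definition Set_cat :: "('x set, 'x \<Rightarrow> 'x) category" where
  "Set_cat = \<lparr>
     Obj = UNIV,
     Hom = (\<lambda>X Y. X \<rightarrow>\<^sub>E Y),
     Ident = (\<lambda>X. \<lambda>x\<in>X. x),
     Comp = (\<lambda>X Y Z g f. compose X g f)\<rparr>"

record ('x, 'f) ord_category = "('x set, 'f) category" +
  Le :: "'x set \<Rightarrow> 'x set \<Rightarrow> 'f \<Rightarrow> 'f \<Rightarrow> bool"
  Incl :: "'x set \<Rightarrow> 'x set \<Rightarrow> ('x \<Rightarrow> 'x) \<Rightarrow> 'f"

locale ord_category_over_Set =
  category K + Incl: category_functor Set_cat K "\<lambda>X. X" "Incl K"
  for K :: "('x, 'f, 'z) ord_category_scheme" +
  assumes Le_refl: "\<lbrakk>X \<in> Obj K; Y \<in> Obj K; f \<in> Hom K X Y\<rbrakk> \<Longrightarrow> Le K X Y f f"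
    and Le_trans: "\<lbrakk>X \<in> Obj K; Y \<in> Obj K; f \<in> Hom K X Y; g \<in> Hom K X Y; h \<in> Hom K X Y;
        Le K X Y f g; Le K X Y g h\<rbrakk> \<Longrightarrow> Le K X Y f h"
    and Le_antisym: "\<lbrakk>X \<in> Obj K; Y \<in> Obj K; f \<in> Hom K X Y; g \<in> Hom K X Y;
        Le K X Y f g; Le K X Y g f\<rbrakk> \<Longrightarrow> f = g"
    and Comp_mono: "\<lbrakk>X \<in> Obj K; Y \<in> Obj K; Z \<in> Obj K;
        f \<in> Hom K X Y; f' \<in> Hom K X Y; g \<in> Hom K Y Z; g' \<in> Hom K Y Z;
        Le K X Y f f'; Le K Y Z g g'\<rbrakk>
      \<Longrightarrow> Le K X Z (Comp K X Y Z g f) (Comp K X Y Z g' f')"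
    and Incl_faithful: "\<lbrakk>X \<in> Obj K; Y \<in> Obj K\<rbrakk> \<Longrightarrow> inj_on (Incl K X Y) (X \<rightarrow>\<^sub>E Y)"

section \<open>Lax functors on a monoid and oplax transformations with components from Set\<close>

text \<open>
  A monoid \<open>N\<close> is regarded as a one-object category in which \<open>m \<otimes> n\<close> is the arrow
  \<open>m\<close> followed by the arrow \<open>n\<close>, so laxness reads
  \<open>\<pi>\<^sub>n \<circ> \<pi>\<^sub>m \<le> \<pi>\<^bsub>m \<otimes> n\<^esub>\<close>. The order of the factors
  matters only for noncommutative \<open>N\<close>. It has to agree with the order in which the Kleisli
  composition below multiplies labels (label of the first step on the left): with
  \<open>\<pi>\<^sub>m \<circ> \<pi>\<^sub>n \<le> \<pi>\<^bsub>m \<otimes> n\<^esub>\<close> instead, labels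
  would be composed in opposite orders in the index monoid and in the Kleisli category, and moving
  a label monoid \<open>M\<close> into the index would produce the opposite monoid of \<open>M\<close>.
\<close>

definition lax_functors ::
  "('n, 'b) monoid_scheme \<Rightarrow> ('x, 'f, 'z) ord_category_scheme \<Rightarrow> ('x set \<times> ('n \<Rightarrow> 'f)) set" where
  "lax_functors N K = {(X, \<pi>). X \<in> Obj K \<and>
     \<pi> \<in> carrier N \<rightarrow>\<^sub>E Hom K X X \<and>
     Le K X X (Ident K X) (\<pi> \<one>\<^bsub>N\<^esub>) \<and>
     (\<forall>m\<in>carrier N. \<forall>n\<in>carrier N. Le K X X (Comp K X X X (\<pi> n) (\<pi> m)) (\<pi> (m \<otimes>\<^bsub>N\<^esub> n)))}"

definition oplax_transformations ::
  "('n, 'b) monoid_scheme \<Rightarrow> ('x, 'f, 'z) ord_category_scheme \<Rightarrow>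
   'x set \<times> ('n \<Rightarrow> 'f) \<Rightarrow> 'x set \<times> ('n \<Rightarrow> 'f) \<Rightarrow> ('x \<Rightarrow> 'x) set" where
  "oplax_transformations N K = (\<lambda>(X, \<pi>) (Y, \<pi>'). {f \<in> X \<rightarrow>\<^sub>E Y. \<forall>n\<in>carrier N.
     Le K X Y (Comp K X X Y (Incl K X Y f) (\<pi> n)) (Comp K X Y Y (\<pi>' n) (Incl K X Y f))})"

text \<open>The category \<open>[N, K]\<^sup>S\<^sup>e\<^sup>t\<close>.\<close>

definition lax_functor_category ::
  "('n, 'b) monoid_scheme \<Rightarrow> ('x, 'f, 'z) ord_category_scheme \<Rightarrow>
   ('x set \<times> ('n \<Rightarrow> 'f), 'x \<Rightarrow> 'x) category" where
  "lax_functor_category N K = \<lparr>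
     Obj = lax_functors N K,
     Hom = oplax_transformations N K,
     Ident = (\<lambda>(X, \<pi>). Ident Set_cat X),
     Comp = (\<lambda>(X, \<pi>) (Y, \<pi>') (Z, \<pi>''). Comp Set_cat X Y Z)\<rparr>"

section \<open>The Kleisli category of the monad \<open>\<P>\<^bsup>\<Sigma>,M\<^esup>\<close>\<close>

text \<open>
  As in \<open>Set_cat\<close>, Kleisli arrows \<open>X \<rightarrow> \<P>(\<Sigma>\<^sub>\<tau> \<times> M \<times> Y)\<close>
  are extensional functions, so that equality of arrows is equality on \<open>X\<close>.
\<close>

text \<open>\<open>\<Sigma>\<^sub>\<tau> = \<Sigma> + {\<tau>}\<close>\<close>

definition tau :: "'s + unit" ("\<tau>") where
  "\<tau> = Inr ()"

definition Sigma_tau :: "'s set \<Rightarrow> ('s + unit) set" where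
  "Sigma_tau \<Sigma> = \<Sigma> <+> {()}"

definition PSM :: "'s set \<Rightarrow> ('m, 'b) monoid_scheme \<Rightarrow> 'x set \<Rightarrow> (('s + unit) \<times> 'm \<times> 'x) set set" where
  "PSM \<Sigma> M X = Pow (Sigma_tau \<Sigma> \<times> carrier M \<times> X)"

type_synonym ('x, 's, 'm) kleisli_map = "'x \<Rightarrow> (('s + unit) \<times> 'm \<times> 'x) set"

definition kleisli_unit :: "('m, 'b) monoid_scheme \<Rightarrow> 'x set \<Rightarrow> ('x, 's, 'm) kleisli_map" where
  "kleisli_unit M X = (\<lambda>x\<in>X. {(\<tau>, \<one>\<^bsub>M\<^esub>, x)})"

definition kleisli_comp ::
  "'s set \<Rightarrow> ('m, 'b) monoid_scheme \<Rightarrow> 'x set \<Rightarrow>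
   ('x, 's, 'm) kleisli_map \<Rightarrow> ('x, 's, 'm) kleisli_map \<Rightarrow> ('x, 's, 'm) kleisli_map" where
  "kleisli_comp \<Sigma> M X g f = (\<lambda>x\<in>X. {(\<sigma>, m \<otimes>\<^bsub>M\<^esub> n, z) | \<sigma> m n z. \<sigma> \<in> Sigma_tau \<Sigma> \<and>
     (\<exists>y. ((\<sigma>, m, y) \<in> f x \<and> (\<tau>, n, z) \<in> g y) \<or> ((\<tau>, m, y) \<in> f x \<and> (\<sigma>, n, z) \<in> g y))})"

definition Kl :: "'s set \<Rightarrow> ('m, 'b) monoid_scheme \<Rightarrow> ('x, ('x, 's, 'm) kleisli_map) ord_category" where
  "Kl \<Sigma> M = \<lparr>
     Obj = UNIV,
     Hom = (\<lambda>X Y. X \<rightarrow>\<^sub>E PSM \<Sigma> M Y),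
     Ident = kleisli_unit M,
     Comp = (\<lambda>X Y Z g f. kleisli_comp \<Sigma> M X g f),
     Le = (\<lambda>X Y f g. \<forall>x\<in>X. f x \<subseteq> g x),
     Incl = (\<lambda>X Y f. compose X (kleisli_unit M Y) f)\<rparr>"

abbreviation trivial_monoid :: "unit monoid" where
  "trivial_monoid \<equiv> singleton_group ()"

section \<open>Well-definedness\<close>

lemma category_Set_cat: "category Set_cat"
  by unfold_locales
    (auto simp: Set_cat_def compose_def PiE_iff extensional_def fun_eq_iff restrict_def)

lemma (in ord_category_over_Set) category_lax_functor_category:
  assumes N: "monoid N"
  shows "category (lax_functor_category N K)"
proof -
  interpret N: monoid N by fact
  interpret S: category Set_cat by (rule category_Set_cat)
  have ObjS: "X \<in> Obj Set_cat" for X :: "'x set" by (simp add: Set_cat_def)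
  have HomS: "Hom Set_cat X Y = X \<rightarrow>\<^sub>E Y" for X Y :: "'x set" by (simp add: Set_cat_def)
  note J_in = Incl.Fa_in[OF ObjS ObjS, unfolded HomS]
  note J_Comp = Incl.Fa_Comp[OF ObjS ObjS ObjS, unfolded HomS]
  have ObjK: "X \<in> Obj K" for X by (rule Incl.Fo_in[OF ObjS])
  have ident: "Ident Set_cat X \<in> oplax_transformations N K (X, \<pi>) (X, \<pi>)"
    if \<pi>: "\<pi> \<in> carrier N \<rightarrow>\<^sub>E Hom K X X" for X \<pi>
  proof -
    have "\<pi> n \<in> Hom K X X" if "n \<in> carrier N" for n using \<pi> that by auto
    then show ?thesis
      using S.Ident_in[OF ObjS, of X]
      by (auto simp: oplax_transformations_def HomS Incl.Fa_Ident[OF ObjS]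
          Comp_Ident_left[OF ObjK ObjK] Comp_Ident_right[OF ObjK ObjK] Le_refl[OF ObjK ObjK])
  qed
  have comp: "Comp Set_cat X Y Z g f \<in> oplax_transformations N K (X, \<pi>) (Z, \<pi>'')"
    if \<pi>: "\<pi> \<in> carrier N \<rightarrow>\<^sub>E Hom K X X" and \<pi>': "\<pi>' \<in> carrier N \<rightarrow>\<^sub>E Hom K Y Y"
      and \<pi>'': "\<pi>'' \<in> carrier N \<rightarrow>\<^sub>E Hom K Z Z"
      and f: "f \<in> oplax_transformations N K (X, \<pi>) (Y, \<pi>')"
      and g: "g \<in> oplax_transformations N K (Y, \<pi>') (Z, \<pi>'')"
    for X Y Z \<pi> \<pi>' \<pi>'' f g
  proof -
    have f': "f \<in> X \<rightarrow>\<^sub>E Y" and g': "g \<in> Y \<rightarrow>\<^sub>E Z"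
      using f g by (auto simp: oplax_transformations_def)
    let ?f = "Incl K X Y f" and ?g = "Incl K Y Z g"
    have Jf: "?f \<in> Hom K X Y" and Jg: "?g \<in> Hom K Y Z" using f' g' by (auto intro: J_in)
    have le: "Le K X Z (Comp K X X Z (Comp K X Y Z ?g ?f) (\<pi> n))
                       (Comp K X Z Z (\<pi>'' n) (Comp K X Y Z ?g ?f))"
      if n: "n \<in> carrier N" for n
    proof -
      have p: "\<pi> n \<in> Hom K X X" "\<pi>' n \<in> Hom K Y Y" "\<pi>'' n \<in> Hom K Z Z"
        using \<pi> \<pi>' \<pi>'' n by auto
      have lf: "Le K X Y (Comp K X X Y ?f (\<pi> n)) (Comp K X Y Y (\<pi>' n) ?f)"
        and lg: "Le K Y Z (Comp K Y Y Z ?g (\<pi>' n)) (Comp K Y Z Z (\<pi>'' n) ?g)"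
        using f g n by (auto simp: oplax_transformations_def)
      note C = Comp_in[OF ObjK ObjK ObjK]
      have 1: "Le K X Z (Comp K X Y Z ?g (Comp K X X Y ?f (\<pi> n)))
                        (Comp K X Y Z ?g (Comp K X Y Y (\<pi>' n) ?f))"
        by (intro Comp_mono[OF ObjK ObjK ObjK] lf C Jf Jg p Le_refl[OF ObjK ObjK])
      have 2: "Le K X Z (Comp K X Y Z (Comp K Y Y Z ?g (\<pi>' n)) ?f)
                        (Comp K X Y Z (Comp K Y Z Z (\<pi>'' n) ?g) ?f)"
        by (intro Comp_mono[OF ObjK ObjK ObjK] lg C Jf Jg p Le_refl[OF ObjK ObjK])
      note A = Comp_assoc[OF ObjK ObjK ObjK ObjK]
      show ?thesis
        by (rule Le_trans[OF ObjK ObjK _ _ _ 1[unfolded A[OF p(1) Jf Jg] A[OF Jf p(2) Jg]]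
              2[folded A[OF Jf Jg p(3)]]])
           (intro C Jf Jg p)+
    qed
    then show ?thesis
      using S.Comp_in[OF ObjS ObjS ObjS, unfolded HomS, OF f' g']
      by (auto simp: oplax_transformations_def J_Comp[OF f' g'])
  qed
  let ?L = "lax_functor_category N K"
  have Obj_D: "snd A \<in> carrier N \<rightarrow>\<^sub>E Hom K (fst A) (fst A)" if "A \<in> Obj ?L" for A
    using that by (auto simp: lax_functor_category_def lax_functors_def)
  have Hom_D: "f \<in> Hom Set_cat (fst A) (fst B)" if "f \<in> Hom ?L A B" for A B f
    using that
    by (auto simp: lax_functor_category_def oplax_transformations_def HomS split: prod.splits)
  have Hom_eq: "Hom ?L A B = oplax_transformations N K (fst A, snd A) (fst B, snd B)" for A B
    by (simp add: lax_functor_category_def)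
  have Ident_eq: "Ident ?L A = Ident Set_cat (fst A)" for A
    by (simp add: lax_functor_category_def case_prod_unfold)
  have Comp_eq: "Comp ?L A B D = Comp Set_cat (fst A) (fst B) (fst D)" for A B D
    by (simp add: lax_functor_category_def case_prod_unfold)
  show ?thesis
  proof
    fix A assume "A \<in> Obj ?L"
    then show "Ident ?L A \<in> Hom ?L A A" unfolding Hom_eq Ident_eq by (intro ident Obj_D)
  next
    fix A B D f g
    assume "A \<in> Obj ?L" "B \<in> Obj ?L" "D \<in> Obj ?L" "f \<in> Hom ?L A B" "g \<in> Hom ?L B D"
    then show "Comp ?L A B D g f \<in> Hom ?L A D"
      using Obj_D unfolding Hom_eq Comp_eq by (intro comp)
  next
    fix A B f assume f: "f \<in> Hom ?L A B"
    show "Comp ?L A A B f (Ident ?L A) = f" "Comp ?L A B B (Ident ?L B) f = f"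
      unfolding Comp_eq Ident_eq
      using S.Comp_Ident_right[OF ObjS ObjS Hom_D[OF f]]
        S.Comp_Ident_left[OF ObjS ObjS Hom_D[OF f]] .
  next
    fix A B D E f g h
    assume "f \<in> Hom ?L A B" "g \<in> Hom ?L B D" "h \<in> Hom ?L D E"
    note H = this[THEN Hom_D]
    show "Comp ?L A D E h (Comp ?L A B D g f) = Comp ?L A B E (Comp ?L B D E h g) f"
      unfolding Comp_eq by (rule S.Comp_assoc[OF ObjS ObjS ObjS ObjS H])
  qed
qed

lemma kleisli_comp_iff:
  "x \<in> X \<Longrightarrow> (\<sigma>, k, z) \<in> kleisli_comp \<Sigma> M X g f x \<longleftrightarrow> \<sigma> \<in> Sigma_tau \<Sigma> \<and>
     (\<exists>m n y. k = m \<otimes>\<^bsub>M\<^esub> n \<and>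
       ((\<sigma>, m, y) \<in> f x \<and> (\<tau>, n, z) \<in> g y \<or> (\<tau>, m, y) \<in> f x \<and> (\<sigma>, n, z) \<in> g y))"
  by (auto simp: kleisli_comp_def)

lemma kleisli_hom_D:
  assumes "f \<in> X \<rightarrow>\<^sub>E PSM \<Sigma> M Y" "x \<in> X" "(\<sigma>, m, y) \<in> f x"
  shows "\<sigma> \<in> Sigma_tau \<Sigma>" "m \<in> carrier M" "y \<in> Y"
  using assms by (auto simp: PSM_def PiE_iff dest!: bspec)

lemma tau_in [simp]: "\<tau> \<in> Sigma_tau \<Sigma>"
  by (auto simp: Sigma_tau_def tau_def)

lemma kleisli_unit_iff [simp]:
  "x \<in> X \<Longrightarrow> (\<sigma>, m, y) \<in> kleisli_unit M X x \<longleftrightarrow> \<sigma> = \<tau> \<and> m = \<one>\<^bsub>M\<^esub> \<and> y = x"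
  by (auto simp: kleisli_unit_def)

lemma kleisli_map_eqI:
  assumes "f \<in> extensional X" "g \<in> extensional X"
    and "\<And>x \<sigma> m y. x \<in> X \<Longrightarrow> (\<sigma>, m, y) \<in> f x \<longleftrightarrow> (\<sigma>, m, y) \<in> g x"
  shows "f = g"
  using assms by (intro extensionalityI[of f X g]) auto

lemma kleisli_comp_extensional [simp]: "kleisli_comp \<Sigma> M X g f \<in> extensional X"
  by (simp add: kleisli_comp_def)

lemma kleisli_comp_in:
  assumes "monoid M" "f \<in> X \<rightarrow>\<^sub>E PSM \<Sigma> M Y" "g \<in> Y \<rightarrow>\<^sub>E PSM \<Sigma> M Z"
  shows "kleisli_comp \<Sigma> M X g f \<in> X \<rightarrow>\<^sub>E PSM \<Sigma> M Z"
proof (rule PiE_I)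
  fix x assume x: "x \<in> X"
  note D = kleisli_hom_D[OF assms(2) x] kleisli_hom_D[OF assms(3)]
  have "p \<in> Sigma_tau \<Sigma> \<times> carrier M \<times> Z" if "p \<in> kleisli_comp \<Sigma> M X g f x" for p
    using that x by (cases p) (auto simp: kleisli_comp_iff dest: D intro!: monoid.m_closed[OF assms(1)])
  then show "kleisli_comp \<Sigma> M X g f x \<in> PSM \<Sigma> M Z" by (auto simp: PSM_def)
qed (auto simp: kleisli_comp_def)

lemma kleisli_comp_unit_right:
  assumes "monoid M" "f \<in> X \<rightarrow>\<^sub>E PSM \<Sigma> M Y"
  shows "kleisli_comp \<Sigma> M X f (kleisli_unit M X) = f"
proof (rule kleisli_map_eqI[of _ X])
  interpret monoid M by fact
  fix x \<sigma> m y assume x: "x \<in> X"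
  note D = kleisli_hom_D[OF assms(2) x]
  show "(\<sigma>, m, y) \<in> kleisli_comp \<Sigma> M X f (kleisli_unit M X) x \<longleftrightarrow> (\<sigma>, m, y) \<in> f x"
  proof
    assume "(\<sigma>, m, y) \<in> f x"
    then show "(\<sigma>, m, y) \<in> kleisli_comp \<Sigma> M X f (kleisli_unit M X) x"
      unfolding kleisli_comp_iff[OF x] using D[of \<sigma> m y] x
      by (intro conjI exI[of _ "\<one>\<^bsub>M\<^esub>"] exI[of _ m] exI[of _ x]) auto
  next
    assume "(\<sigma>, m, y) \<in> kleisli_comp \<Sigma> M X f (kleisli_unit M X) x"
    then obtain k where "m = \<one>\<^bsub>M\<^esub> \<otimes>\<^bsub>M\<^esub> k" "(\<sigma>, k, y) \<in> f x"
      unfolding kleisli_comp_iff[OF x] using x by auto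
    then show "(\<sigma>, m, y) \<in> f x" using D(2) by simp
  qed
qed (use assms in \<open>auto simp: PiE_iff\<close>)

lemma kleisli_comp_unit_left:
  assumes "monoid M" "f \<in> X \<rightarrow>\<^sub>E PSM \<Sigma> M Y"
  shows "kleisli_comp \<Sigma> M X (kleisli_unit M Y) f = f"
proof (rule kleisli_map_eqI[of _ X])
  interpret monoid M by fact
  fix x \<sigma> m y assume x: "x \<in> X"
  note D = kleisli_hom_D[OF assms(2) x]
  have u: "(a, n, z) \<in> kleisli_unit M Y w \<longleftrightarrow> a = \<tau> \<and> n = \<one>\<^bsub>M\<^esub> \<and> z = w"
    if "(b, k, w) \<in> f x" for a b n k z w
    using D(3)[OF that] by simp
  show "(\<sigma>, m, y) \<in> kleisli_comp \<Sigma> M X (kleisli_unit M Y) f x \<longleftrightarrow> (\<sigma>, m, y) \<in> f x"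
  proof
    assume "(\<sigma>, m, y) \<in> f x"
    then show "(\<sigma>, m, y) \<in> kleisli_comp \<Sigma> M X (kleisli_unit M Y) f x"
      unfolding kleisli_comp_iff[OF x] using D[of \<sigma> m y] u
      by (intro conjI exI[of _ m] exI[of _ "\<one>\<^bsub>M\<^esub>"] exI[of _ y]) auto
  next
    assume "(\<sigma>, m, y) \<in> kleisli_comp \<Sigma> M X (kleisli_unit M Y) f x"
    then obtain k where "m = k \<otimes>\<^bsub>M\<^esub> \<one>\<^bsub>M\<^esub>" "(\<sigma>, k, y) \<in> f x"
      unfolding kleisli_comp_iff[OF x] by (auto simp: u)
    then show "(\<sigma>, m, y) \<in> f x" using D(2) by simp
  qed
qed (use assms in \<open>auto simp: PiE_iff\<close>)

lemma kleisli_comp_assoc: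
  assumes "monoid M" "f \<in> W \<rightarrow>\<^sub>E PSM \<Sigma> M X" "g \<in> X \<rightarrow>\<^sub>E PSM \<Sigma> M Y" "h \<in> Y \<rightarrow>\<^sub>E PSM \<Sigma> M Z"
  shows "kleisli_comp \<Sigma> M W h (kleisli_comp \<Sigma> M W g f)
       = kleisli_comp \<Sigma> M W (kleisli_comp \<Sigma> M X h g) f"
proof (rule kleisli_map_eqI[of _ W])
  interpret monoid M by fact
  fix w \<sigma> k z assume w: "w \<in> W"
  note Df = kleisli_hom_D[OF assms(2) w] and Dg = kleisli_hom_D[OF assms(3)]
    and Dh = kleisli_hom_D[OF assms(4)]
  let ?L = "kleisli_comp \<Sigma> M W h (kleisli_comp \<Sigma> M W g f) w"
  let ?R = "kleisli_comp \<Sigma> M W (kleisli_comp \<Sigma> M X h g) f w"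
  let ?P = "\<lambda>l m n x y. (\<sigma>, l, x) \<in> f w \<and> (\<tau>, m, y) \<in> g x \<and> (\<tau>, n, z) \<in> h y \<or>
      (\<tau>, l, x) \<in> f w \<and> (\<sigma>, m, y) \<in> g x \<and> (\<tau>, n, z) \<in> h y \<or>
      (\<tau>, l, x) \<in> f w \<and> (\<tau>, m, y) \<in> g x \<and> (\<sigma>, n, z) \<in> h y"
  have assoc: "(l \<otimes>\<^bsub>M\<^esub> m) \<otimes>\<^bsub>M\<^esub> n = l \<otimes>\<^bsub>M\<^esub> (m \<otimes>\<^bsub>M\<^esub> n)" if "?P l m n x y" for l m n x y
  proof -
    have x: "x \<in> X" "l \<in> carrier M" using that by (auto dest: Df)
    then have y: "y \<in> Y" "m \<in> carrier M" using that by (auto dest: Dg[OF x(1)])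
    then have "n \<in> carrier M" using that by (auto dest: Dh[OF y(1)])
    then show ?thesis using x y by (simp add: m_assoc)
  qed
  show "(\<sigma>, k, z) \<in> ?L \<longleftrightarrow> (\<sigma>, k, z) \<in> ?R"
  proof
    assume "(\<sigma>, k, z) \<in> ?L"
    then obtain i n y where s: "\<sigma> \<in> Sigma_tau \<Sigma>" and k: "k = i \<otimes>\<^bsub>M\<^esub> n"
      and c: "(\<sigma>, i, y) \<in> kleisli_comp \<Sigma> M W g f w \<and> (\<tau>, n, z) \<in> h y \<or>
        (\<tau>, i, y) \<in> kleisli_comp \<Sigma> M W g f w \<and> (\<sigma>, n, z) \<in> h y"
      unfolding kleisli_comp_iff[OF w, of _ _ _ _ _ h] by blast
    from c obtain l m x where i: "i = l \<otimes>\<^bsub>M\<^esub> m" and P: "?P l m n x y"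
      unfolding kleisli_comp_iff[OF w] by blast
    have x: "x \<in> X" using P Df(3) by blast
    have "k = l \<otimes>\<^bsub>M\<^esub> (m \<otimes>\<^bsub>M\<^esub> n)" using assoc[OF P] by (simp add: k i)
    moreover have "(\<sigma>, l, x) \<in> f w \<and> (\<tau>, m \<otimes>\<^bsub>M\<^esub> n, z) \<in> kleisli_comp \<Sigma> M X h g x \<or>
      (\<tau>, l, x) \<in> f w \<and> (\<sigma>, m \<otimes>\<^bsub>M\<^esub> n, z) \<in> kleisli_comp \<Sigma> M X h g x"
      unfolding kleisli_comp_iff[OF x] using P s tau_in by blast
    ultimately show "(\<sigma>, k, z) \<in> ?R"
      unfolding kleisli_comp_iff[OF w] using s by blast
  next
    assume "(\<sigma>, k, z) \<in> ?R"
    then obtain l j x where s: "\<sigma> \<in> Sigma_tau \<Sigma>" and k: "k = l \<otimes>\<^bsub>M\<^esub> j"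
      and c: "(\<sigma>, l, x) \<in> f w \<and> (\<tau>, j, z) \<in> kleisli_comp \<Sigma> M X h g x \<or>
        (\<tau>, l, x) \<in> f w \<and> (\<sigma>, j, z) \<in> kleisli_comp \<Sigma> M X h g x"
      unfolding kleisli_comp_iff[OF w] by blast
    have x: "x \<in> X" using c Df(3) by blast
    from c obtain m n y where j: "j = m \<otimes>\<^bsub>M\<^esub> n" and P: "?P l m n x y"
      unfolding kleisli_comp_iff[OF x] by blast
    have "k = (l \<otimes>\<^bsub>M\<^esub> m) \<otimes>\<^bsub>M\<^esub> n" using assoc[OF P] by (simp add: k j)
    moreover have "(\<sigma>, l \<otimes>\<^bsub>M\<^esub> m, y) \<in> kleisli_comp \<Sigma> M W g f w \<and> (\<tau>, n, z) \<in> h y \<or>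
      (\<tau>, l \<otimes>\<^bsub>M\<^esub> m, y) \<in> kleisli_comp \<Sigma> M W g f w \<and> (\<sigma>, n, z) \<in> h y"
      unfolding kleisli_comp_iff[OF w] using P s tau_in by blast
    ultimately show "(\<sigma>, k, z) \<in> ?L"
      unfolding kleisli_comp_iff[OF w, of _ _ _ _ _ h] using s by blast
  qed
qed auto

lemma kleisli_unit_in: "monoid M \<Longrightarrow> kleisli_unit M X \<in> X \<rightarrow>\<^sub>E PSM \<Sigma> M X"
  by (auto simp: kleisli_unit_def PSM_def monoid.one_closed)

lemma compose_kleisli_unit_in:
  "monoid M \<Longrightarrow> f \<in> X \<rightarrow>\<^sub>E Y \<Longrightarrow> compose X (kleisli_unit M Y) f \<in> X \<rightarrow>\<^sub>E PSM \<Sigma> M Y"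
  by (auto simp: PiE_iff compose_def kleisli_unit_def PSM_def monoid.one_closed)

lemma compose_kleisli_unit_iff:
  "f \<in> X \<rightarrow>\<^sub>E Y \<Longrightarrow> x \<in> X \<Longrightarrow>
   (\<sigma>, m, y) \<in> compose X (kleisli_unit M Y) f x \<longleftrightarrow> \<sigma> = \<tau> \<and> m = \<one>\<^bsub>M\<^esub> \<and> y = f x"
  by (auto simp: compose_def kleisli_unit_def PiE_iff)

lemma category_Kl:
  assumes "monoid M"
  shows "category (Kl \<Sigma> M)"
  by unfold_locales
    (simp_all add: Kl_def assms kleisli_unit_in kleisli_comp_in kleisli_comp_unit_left
      kleisli_comp_unit_right kleisli_comp_assoc)

lemma ord_category_over_Set_Kl:
  fixes \<Sigma> :: "'s set" and M :: "('m, 'b) monoid_scheme"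
  assumes "monoid M"
  shows "ord_category_over_Set (Kl \<Sigma> M :: ('x, ('x, 's, 'm) kleisli_map) ord_category)"
proof -
  let ?K = "Kl \<Sigma> M :: ('x, ('x, 's, 'm) kleisli_map) ord_category"
  interpret monoid M by fact
  interpret S: category Set_cat by (rule category_Set_cat)
  interpret K: category "Kl \<Sigma> M :: ('x, ('x, 's, 'm) kleisli_map) ord_category"
    by (rule category_Kl[OF assms])
  have "category_functor Set_cat ?K (\<lambda>X. X) (Incl ?K)"
  proof
    fix X Y Z :: "'x set" and f g
    assume "f \<in> Hom Set_cat X Y" "g \<in> Hom Set_cat Y Z"
    then have fg: "f \<in> X \<rightarrow>\<^sub>E Y" "g \<in> Y \<rightarrow>\<^sub>E Z" "compose X g f \<in> X \<rightarrow>\<^sub>E Z"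
      by (auto simp: Set_cat_def compose_def)
    have "compose X (kleisli_unit M Z) (compose X g f)
      = kleisli_comp \<Sigma> M X (compose Y (kleisli_unit M Z) g) (compose X (kleisli_unit M Y) f)"
    proof (rule kleisli_map_eqI[of _ X])
      fix x \<sigma> m y assume x: "x \<in> X"
      then have fx: "f x \<in> Y" using fg by auto
      have gf: "compose X g f x = g (f x)" using x by (rule compose_eq)
      then show "(\<sigma>, m, y) \<in> compose X (kleisli_unit M Z) (compose X g f) x \<longleftrightarrow>
        (\<sigma>, m, y) \<in> kleisli_comp \<Sigma> M X (compose Y (kleisli_unit M Z) g)
          (compose X (kleisli_unit M Y) f) x"
        unfolding kleisli_comp_iff[OF x] compose_kleisli_unit_iff[OF fg(3) x]
          compose_kleisli_unit_iff[OF fg(1) x] gf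
        by (auto simp: compose_kleisli_unit_iff[OF fg(2) fx])
    qed auto
    then show "Incl ?K X Z (Comp Set_cat X Y Z g f)
      = Comp ?K X Y Z (Incl ?K Y Z g) (Incl ?K X Y f)"
      by (simp add: Kl_def Set_cat_def)
  next
    fix X Y :: "'x set" and f
    assume "f \<in> Hom Set_cat X Y"
    then show "Incl ?K X Y f \<in> Hom ?K X Y"
      by (simp add: Kl_def Set_cat_def assms compose_kleisli_unit_in)
  qed (auto simp: Kl_def Set_cat_def compose_def kleisli_unit_def restrict_def fun_eq_iff)
  moreover have "ord_category_over_Set_axioms ?K"
  proof
    fix X Y Z :: "'x set" and f f' g g'
    assume f: "f \<in> Hom ?K X Y" "f' \<in> Hom ?K X Y"
      and "Le ?K X Y f f'" "Le ?K Y Z g g'"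
    then have le: "\<And>x. x \<in> X \<Longrightarrow> f x \<subseteq> f' x" "\<And>y. y \<in> Y \<Longrightarrow> g y \<subseteq> g' y"
      by (auto simp: Kl_def)
    have "kleisli_comp \<Sigma> M X g f x \<subseteq> kleisli_comp \<Sigma> M X g' f' x" if x: "x \<in> X" for x
    proof
      fix p assume p: "p \<in> kleisli_comp \<Sigma> M X g f x"
      have Y: "y \<in> Y" if "(\<sigma>, m, y) \<in> f x" for \<sigma> m y
        using f(1) that x by (auto simp: Kl_def dest: kleisli_hom_D(3))
      obtain \<sigma> k z where p': "p = (\<sigma>, k, z)" by (cases p)
      have f'_I: "(\<sigma>, m, y) \<in> f' x" if "(\<sigma>, m, y) \<in> f x" for \<sigma> m y
        using le(1)[OF x] that by blast
      have g'_I: "(\<sigma>, n, z) \<in> g' y" if "(\<sigma>', m, y) \<in> f x" "(\<sigma>, n, z) \<in> g y" for \<sigma> \<sigma>' m n y z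
        using le(2)[OF Y[OF that(1)]] that(2) by blast
      obtain m n y where s: "\<sigma> \<in> Sigma_tau \<Sigma>" and k: "k = m \<otimes>\<^bsub>M\<^esub> n"
        and "(\<sigma>, m, y) \<in> f x \<and> (\<tau>, n, z) \<in> g y \<or> (\<tau>, m, y) \<in> f x \<and> (\<sigma>, n, z) \<in> g y"
        using p unfolding p' kleisli_comp_iff[OF x] by blast
      then have "(\<sigma>, m, y) \<in> f' x \<and> (\<tau>, n, z) \<in> g' y \<or> (\<tau>, m, y) \<in> f' x \<and> (\<sigma>, n, z) \<in> g' y"
        using f'_I g'_I by meson
      then show "p \<in> kleisli_comp \<Sigma> M X g' f' x"
        unfolding p' kleisli_comp_iff[OF x]
        by (intro conjI[OF s] exI[of _ m] exI[of _ n] exI[of _ y] conjI[OF k])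
    qed
    then show "Le ?K X Z (Comp ?K X Y Z g f) (Comp ?K X Y Z g' f')"
      by (simp add: Kl_def)
  next
    fix X Y :: "'x set"
    have "f = g"
      if fg: "f \<in> X \<rightarrow>\<^sub>E Y" "g \<in> X \<rightarrow>\<^sub>E Y"
        and eq: "compose X (kleisli_unit M Y :: ('x, 's, 'm) kleisli_map) f
          = compose X (kleisli_unit M Y) g" for f g
    proof (rule PiE_ext[OF fg])
      fix x assume x: "x \<in> X"
      have "(\<tau>, \<one>\<^bsub>M\<^esub>, f x) \<in> compose X (kleisli_unit M Y :: ('x, 's, 'm) kleisli_map) f x"
        by (simp add: compose_kleisli_unit_iff[OF fg(1) x])
      then show "f x = g x" unfolding eq by (simp add: compose_kleisli_unit_iff[OF fg(2) x])
    qed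
    then show "inj_on (Incl ?K X Y) (X \<rightarrow>\<^sub>E Y)"
      by (auto simp: Kl_def inj_on_def)
  next
    fix X Y :: "'x set" and f g
    assume "f \<in> Hom ?K X Y" "g \<in> Hom ?K X Y"
      "Le ?K X Y f g" "Le ?K X Y g f"
    then have "f \<in> extensional X" "g \<in> extensional X" "\<forall>x\<in>X. f x \<subseteq> g x" "\<forall>x\<in>X. g x \<subseteq> f x"
      by (simp_all add: Kl_def PiE_iff)
    then show "f = g" by (intro extensionalityI[of f X g] equalityI) simp_all
  next
    fix X Y :: "'x set" and f g h
    assume "Le ?K X Y f g" "Le ?K X Y g h"
    then show "Le ?K X Y f h" by (simp add: Kl_def) (meson subset_trans)
  qed (simp add: Kl_def)
  ultimately show ?thesis
    by (intro ord_category_over_Set.intro K.category_axioms)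
qed

end

theory Submission
  imports Defs
begin

text \<open>
  An arrow \<open>X \<rightarrow> \<P>(\<Sigma>\<^sub>\<tau> \<times> M \<times> X)\<close> is the same as an \<open>M\<close>-indexed family of arrows
  \<open>X \<rightarrow> \<P>(\<Sigma>\<^sub>\<tau> \<times> X)\<close>. In terms of transitions \<open>(\<sigma>, m, y) \<in> \<pi>\<^sub>n x\<close>, the lax functor
  conditions and the condition on transformations treat the index \<open>n\<close> and the label \<open>m\<close> alike,
  so moving \<open>m\<close> into the index preserves and reflects them.
\<close>

text \<open>Inclusion of a Kleisli composite in an arrow is a closure rule for two-step paths of
  which at most one step carries a label other than \<tau>. This turns laxness into a condition on
  single transitions, where index and label can be traded.\<close>

lemma lax_functors_Kl_iff:
  "(X, \<pi>) \<in> lax_functors N (Kl \<Sigma> M) \<longleftrightarrow>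
     \<pi> \<in> carrier N \<rightarrow>\<^sub>E (X \<rightarrow>\<^sub>E PSM \<Sigma> M X) \<and>
     (\<forall>x\<in>X. (\<tau>, \<one>\<^bsub>M\<^esub>, x) \<in> \<pi> \<one>\<^bsub>N\<^esub> x) \<and>
     (\<forall>m\<in>carrier N. \<forall>n\<in>carrier N. \<forall>x\<in>X. \<forall>\<sigma>\<in>Sigma_tau \<Sigma>. \<forall>k l y z.
        (\<sigma>, k, y) \<in> \<pi> m x \<and> (\<tau>, l, z) \<in> \<pi> n y \<or> (\<tau>, k, y) \<in> \<pi> m x \<and> (\<sigma>, l, z) \<in> \<pi> n y
        \<longrightarrow> (\<sigma>, k \<otimes>\<^bsub>M\<^esub> l, z) \<in> \<pi> (m \<otimes>\<^bsub>N\<^esub> n) x)"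
proof -
  have comp: "kleisli_comp \<Sigma> M X g f x \<subseteq> h x \<longleftrightarrow> (\<forall>\<sigma>\<in>Sigma_tau \<Sigma>. \<forall>k l y z.
      (\<sigma>, k, y) \<in> f x \<and> (\<tau>, l, z) \<in> g y \<or> (\<tau>, k, y) \<in> f x \<and> (\<sigma>, l, z) \<in> g y
      \<longrightarrow> (\<sigma>, k \<otimes>\<^bsub>M\<^esub> l, z) \<in> h x)" if "x \<in> X" for f g h :: "('a, 'c, 'd) kleisli_map" and x
    using that unfolding kleisli_comp_def by (simp add: subset_eq) blast
  show ?thesis
    by (auto simp: lax_functors_def Kl_def kleisli_unit_def comp)
qed

text \<open>The image of \<open>f\<close> in the Kleisli category has only the transitions
  \<open>(\<tau>, \<one>, f x)\<close>, so composing with it on the left renames targets and on the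
  right moves the source. The oplax condition therefore says that \<open>f\<close> is a functional
  simulation preserving index and label.\<close>

lemma oplax_transformations_Kl_iff:
  assumes "monoid M"
    and "\<pi> \<in> carrier N \<rightarrow>\<^sub>E (X \<rightarrow>\<^sub>E PSM \<Sigma> M X)" and "\<pi>' \<in> carrier N \<rightarrow>\<^sub>E (Y \<rightarrow>\<^sub>E PSM \<Sigma> M Y)"
  shows "f \<in> oplax_transformations N (Kl \<Sigma> M) (X, \<pi>) (Y, \<pi>') \<longleftrightarrow>
    f \<in> X \<rightarrow>\<^sub>E Y \<and> (\<forall>n\<in>carrier N. \<forall>x\<in>X. \<forall>\<sigma> m y.
      (\<sigma>, m, y) \<in> \<pi> n x \<longrightarrow> (\<sigma>, m, f y) \<in> \<pi>' n (f x))"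
proof -
  interpret monoid M by fact
  have key: "kleisli_comp \<Sigma> M X (compose X (kleisli_unit M Y) f) (\<pi> n) x
        \<subseteq> kleisli_comp \<Sigma> M X (\<pi>' n) (compose X (kleisli_unit M Y) f) x \<longleftrightarrow>
      (\<forall>\<sigma> m y. (\<sigma>, m, y) \<in> \<pi> n x \<longrightarrow> (\<sigma>, m, f y) \<in> \<pi>' n (f x))"
    if f: "f \<in> X \<rightarrow>\<^sub>E Y" and n: "n \<in> carrier N" and x: "x \<in> X" for n x
  proof -
    have fx: "f x \<in> Y" using f x by auto
    have D: "\<sigma> \<in> Sigma_tau \<Sigma>" "m \<in> carrier M" "y \<in> X" if "(\<sigma>, m, y) \<in> \<pi> n x" for \<sigma> m y
      using kleisli_hom_D[OF PiE_mem[OF assms(2) n] x that] by auto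
    have D': "\<sigma> \<in> Sigma_tau \<Sigma>" "m \<in> carrier M" if "(\<sigma>, m, y) \<in> \<pi>' n (f x)" for \<sigma> m y
      using kleisli_hom_D[OF PiE_mem[OF assms(3) n] fx that] by auto
    \<comment> \<open>The second step is forced to be \<open>(\<tau>, \<one>, f y)\<close>. Hence
      the two alternatives for the position of \<sigma> coincide, and the unit law, valid because
      the label lies in the carrier, removes the second factor.\<close>
    have L: "(\<sigma>, k, z) \<in> kleisli_comp \<Sigma> M X (compose X (kleisli_unit M Y) f) (\<pi> n) x \<longleftrightarrow>
        (\<exists>y. (\<sigma>, k, y) \<in> \<pi> n x \<and> z = f y)" for \<sigma> k z
    proof
      assume "(\<sigma>, k, z) \<in> kleisli_comp \<Sigma> M X (compose X (kleisli_unit M Y) f) (\<pi> n) x"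
      then obtain l m y a b where "k = l \<otimes>\<^bsub>M\<^esub> m" "(a, l, y) \<in> \<pi> n x"
        "(b, m, z) \<in> compose X (kleisli_unit M Y) f y" "a = \<sigma> \<and> b = \<tau> \<or> a = \<tau> \<and> b = \<sigma>"
        unfolding kleisli_comp_iff[OF x] by blast
      then show "\<exists>y. (\<sigma>, k, y) \<in> \<pi> n x \<and> z = f y"
        using D compose_kleisli_unit_iff[OF f D(3)] by (metis r_one)
    next
      assume "\<exists>y. (\<sigma>, k, y) \<in> \<pi> n x \<and> z = f y"
      then obtain y where y: "(\<sigma>, k, y) \<in> \<pi> n x" "z = f y" by blast
      then show "(\<sigma>, k, z) \<in> kleisli_comp \<Sigma> M X (compose X (kleisli_unit M Y) f) (\<pi> n) x"
        unfolding kleisli_comp_iff[OF x] using D[OF y(1)] compose_kleisli_unit_iff[OF f]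
        by (metis r_one)
    qed
    have R: "(\<sigma>, k, z) \<in> kleisli_comp \<Sigma> M X (\<pi>' n) (compose X (kleisli_unit M Y) f) x \<longleftrightarrow>
        (\<sigma>, k, z) \<in> \<pi>' n (f x)" for \<sigma> k z
      unfolding kleisli_comp_iff[OF x] compose_kleisli_unit_iff[OF f x]
      using D' by (metis l_one)
    show ?thesis by (simp only: subset_iff split_paired_All L R) blast
  qed
  show ?thesis by (simp add: oplax_transformations_def Kl_def key cong: conj_cong)
qed

lemma category_lax_functor_category_Kl:
  "monoid M \<Longrightarrow> monoid N \<Longrightarrow> category (lax_functor_category N (Kl \<Sigma> M))"
  by (rule ord_category_over_Set.category_lax_functor_category[OF ord_category_over_Set_Kl])

text \<open>Identities and composition in these categories depend only on the carrier sets. A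
  bijection on objects that fixes carriers and leaves the hom-sets equal thus extends to an
  isomorphism acting as the identity on arrows.\<close>

lemma lax_functor_category_isoI:
  assumes cat: "category (lax_functor_category N K)" "category (lax_functor_category N' K')"
    and F: "\<And>X \<pi>. (X, \<pi>) \<in> lax_functors N K \<Longrightarrow> (X, F X \<pi>) \<in> lax_functors N' K'"
    and G: "\<And>X \<rho>. (X, \<rho>) \<in> lax_functors N' K' \<Longrightarrow> (X, G X \<rho>) \<in> lax_functors N K"
    and GF: "\<And>X \<pi>. (X, \<pi>) \<in> lax_functors N K \<Longrightarrow> G X (F X \<pi>) = \<pi>"
    and FG: "\<And>X \<rho>. (X, \<rho>) \<in> lax_functors N' K' \<Longrightarrow> F X (G X \<rho>) = \<rho>"
    and hom: "\<And>X \<pi> Y \<pi>'. (X, \<pi>) \<in> lax_functors N K \<Longrightarrow> (Y, \<pi>') \<in> lax_functors N K \<Longrightarrow>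
      oplax_transformations N' K' (X, F X \<pi>) (Y, F Y \<pi>') = oplax_transformations N K (X, \<pi>) (Y, \<pi>')"
  shows "lax_functor_category N K \<cong>\<^sub>C lax_functor_category N' K'"
proof -
  have hom': "oplax_transformations N K (X, G X \<rho>) (Y, G Y \<rho>')
      = oplax_transformations N' K' (X, \<rho>) (Y, \<rho>')"
    if "(X, \<rho>) \<in> lax_functors N' K'" "(Y, \<rho>') \<in> lax_functors N' K'" for X \<rho> Y \<rho>'
    using hom[OF that[THEN G]] that by (simp add: FG)
  let ?Fo = "\<lambda>(X, \<pi>). (X, F X \<pi>)" and ?Go = "\<lambda>(X, \<rho>). (X, G X \<rho>)"
  have "category_functor (lax_functor_category N K) (lax_functor_category N' K') ?Fo (\<lambda>_ _ f. f)"
    by (intro category_functor.intro category_functor_axioms.intro cat)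
      (auto simp: lax_functor_category_def F hom split: prod.splits)
  moreover have
    "category_functor (lax_functor_category N' K') (lax_functor_category N K) ?Go (\<lambda>_ _ f. f)"
    by (intro category_functor.intro category_functor_axioms.intro cat)
      (auto simp: lax_functor_category_def G hom' split: prod.splits)
  moreover have "\<forall>A\<in>Obj (lax_functor_category N K). ?Go (?Fo A) = A"
    "\<forall>A\<in>Obj (lax_functor_category N' K'). ?Fo (?Go A) = A"
    by (auto simp: lax_functor_category_def GF FG)
  ultimately show ?thesis
    unfolding isomorphic_categories_def
    by (intro exI[of _ ?Fo] exI[of _ ?Go] exI[of _ "\<lambda>_ _ f. f"]) simp
qed

text \<open>Slices \<open>\<pi> n\<close> at each label. \<open>u\<close> is left free because
  \<open>unit\<close> has a single value; the restrictions make the result extensional, as the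
  hom-sets require.\<close>

definition labels_to_index ::
  "('n, 'c) monoid_scheme \<Rightarrow> ('m, 'b) monoid_scheme \<Rightarrow> 'x set \<Rightarrow>
   ('n \<Rightarrow> ('x, 's, 'm) kleisli_map) \<Rightarrow> 'n \<times> 'm \<Rightarrow> ('x, 's, unit) kleisli_map" where
  "labels_to_index N M X \<pi> =
     (\<lambda>p\<in>carrier N \<times> carrier M. \<lambda>x\<in>X. {(\<sigma>, u, y). (\<sigma>, snd p, y) \<in> \<pi> (fst p) x})"

text \<open>The condition \<open>m \<in> carrier M\<close> guards against indices outside the
  product carrier, where an extensional \<rho> is \<open>undefined\<close> and says nothing about
  transitions.\<close>

definition index_to_labels ::
  "('n, 'c) monoid_scheme \<Rightarrow> ('m, 'b) monoid_scheme \<Rightarrow> 'x set \<Rightarrow>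
   ('n \<times> 'm \<Rightarrow> ('x, 's, unit) kleisli_map) \<Rightarrow> 'n \<Rightarrow> ('x, 's, 'm) kleisli_map" where
  "index_to_labels N M X \<rho> =
     (\<lambda>n\<in>carrier N. \<lambda>x\<in>X. {(\<sigma>, m, y). m \<in> carrier M \<and> (\<sigma>, (), y) \<in> \<rho> (n, m) x})"

lemma labels_to_index_iff:
  "n \<in> carrier N \<Longrightarrow> m \<in> carrier M \<Longrightarrow> x \<in> X \<Longrightarrow>
   (\<sigma>, u, y) \<in> labels_to_index N M X \<pi> (n, m) x \<longleftrightarrow> (\<sigma>, m, y) \<in> \<pi> n x"
  by (simp add: labels_to_index_def)

lemma index_to_labels_iff:
  "n \<in> carrier N \<Longrightarrow> x \<in> X \<Longrightarrow>
   (\<sigma>, m, y) \<in> index_to_labels N M X \<rho> n x \<longleftrightarrow> m \<in> carrier M \<and> (\<sigma>, (), y) \<in> \<rho> (n, m) x"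
  by (simp add: index_to_labels_def)

lemma labels_to_index_in:
  assumes "\<pi> \<in> carrier N \<rightarrow>\<^sub>E (X \<rightarrow>\<^sub>E PSM \<Sigma> M X)"
  shows "labels_to_index N M X \<pi> \<in> carrier (N \<times>\<times> M) \<rightarrow>\<^sub>E (X \<rightarrow>\<^sub>E PSM \<Sigma> trivial_monoid X)"
  unfolding labels_to_index_def DirProd_def PSM_def
  by (auto simp: restrict_PiE_iff dest: kleisli_hom_D[OF PiE_mem[OF assms]])

lemma index_to_labels_in:
  assumes "\<rho> \<in> carrier (N \<times>\<times> M) \<rightarrow>\<^sub>E (X \<rightarrow>\<^sub>E PSM \<Sigma> trivial_monoid X)"
  shows "index_to_labels N M X \<rho> \<in> carrier N \<rightarrow>\<^sub>E (X \<rightarrow>\<^sub>E PSM \<Sigma> M X)"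
proof -
  have "(n, m) \<in> carrier (N \<times>\<times> M)" if "n \<in> carrier N" "m \<in> carrier M" for n m
    using that by simp
  note D = kleisli_hom_D[OF PiE_mem[OF assms this]]
  show ?thesis
    unfolding index_to_labels_def PSM_def by (auto simp: restrict_PiE_iff dest: D)
qed

text \<open>Every label occurring in \<open>\<pi> n x\<close> lies in the carrier of
  \<open>M\<close>, so the restriction to carrier labels loses no transition.\<close>

lemma index_to_labels_labels_to_index:
  assumes \<pi>: "\<pi> \<in> carrier N \<rightarrow>\<^sub>E (X \<rightarrow>\<^sub>E PSM \<Sigma> M X)"
  shows "index_to_labels N M X (labels_to_index N M X \<pi>) = \<pi>"
proof (rule PiE_ext[OF index_to_labels_in[OF labels_to_index_in[OF \<pi>]] \<pi>])
  fix n assume n: "n \<in> carrier N"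
  have \<pi>n: "\<pi> n \<in> X \<rightarrow>\<^sub>E PSM \<Sigma> M X" using \<pi> n by auto
  show "index_to_labels N M X (labels_to_index N M X \<pi>) n = \<pi> n"
  proof (rule kleisli_map_eqI[of _ X])
    show "\<pi> n \<in> extensional X" using \<pi>n by (simp add: PiE_iff)
  qed (use n kleisli_hom_D(2)[OF \<pi>n] in
      \<open>auto simp: index_to_labels_iff labels_to_index_iff index_to_labels_def[of N]\<close>)
qed

lemma labels_to_index_index_to_labels:
  assumes \<rho>: "\<rho> \<in> carrier (N \<times>\<times> M) \<rightarrow>\<^sub>E (X \<rightarrow>\<^sub>E PSM \<Sigma> trivial_monoid X)"
  shows "labels_to_index N M X (index_to_labels N M X \<rho>) = \<rho>"
proof (rule PiE_ext[OF labels_to_index_in[OF index_to_labels_in[OF \<rho>]] \<rho>])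
  fix p assume p: "p \<in> carrier (N \<times>\<times> M)"
  then obtain n m where nm: "p = (n, m)" "n \<in> carrier N" "m \<in> carrier M" by auto
  have \<rho>p: "\<rho> p \<in> X \<rightarrow>\<^sub>E PSM \<Sigma> trivial_monoid X" using \<rho> p by auto
  show "labels_to_index N M X (index_to_labels N M X \<rho>) p = \<rho> p"
  proof (rule kleisli_map_eqI[of _ X])
    show "\<rho> p \<in> extensional X" using \<rho>p by (simp add: PiE_iff)
  qed (use nm in \<open>auto simp: index_to_labels_iff labels_to_index_iff labels_to_index_def[of N]\<close>)
qed

text \<open>Multiplication in \<open>N \<times>\<times> M\<close> is componentwise, so its second
  component does to indices what Kleisli composition does to labels, with the first step on the left
  in both; the unit \<open>(\<one>, \<one>)\<close> likewise absorbs the label of \<eta>. As an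
  equivalence it serves both directions of the isomorphism.\<close>

lemma labels_to_index_lax_iff:
  assumes "monoid M" "monoid N" and \<pi>: "\<pi> \<in> carrier N \<rightarrow>\<^sub>E (X \<rightarrow>\<^sub>E PSM \<Sigma> M X)"
  shows "(X, labels_to_index N M X \<pi>) \<in> lax_functors (N \<times>\<times> M) (Kl \<Sigma> trivial_monoid) \<longleftrightarrow>
    (X, \<pi>) \<in> lax_functors N (Kl \<Sigma> M)"
proof -
  interpret M: monoid M by fact
  interpret N: monoid N by fact
  let ?\<rho> = "labels_to_index N M X \<pi>"
  note D = kleisli_hom_D[OF PiE_mem[OF \<pi>]]
  have unit: "(\<tau>, (), x) \<in> ?\<rho> (\<one>\<^bsub>N\<^esub>, \<one>\<^bsub>M\<^esub>) x \<longleftrightarrow> (\<tau>, \<one>\<^bsub>M\<^esub>, x) \<in> \<pi> \<one>\<^bsub>N\<^esub> x" if "x \<in> X" for x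
    using that by (simp add: labels_to_index_iff)
  have step: "(\<sigma>, (), y) \<in> ?\<rho> (n, m) x \<longleftrightarrow> (\<sigma>, m, y) \<in> \<pi> n x"
    if "n \<in> carrier N" "m \<in> carrier M" "x \<in> X" for n m x \<sigma> y
    using that by (simp add: labels_to_index_iff)
  have D\<rho>: "y \<in> X" if "(\<sigma>, u, y) \<in> ?\<rho> (n, m) x" "n \<in> carrier N" "m \<in> carrier M" "x \<in> X"
    for \<sigma> u y n m x
    using D[OF that(2,4)] that by (auto simp: labels_to_index_iff)
  have "(\<forall>p\<in>carrier (N \<times>\<times> M). \<forall>q\<in>carrier (N \<times>\<times> M). \<forall>x\<in>X. \<forall>\<sigma>\<in>Sigma_tau \<Sigma>. \<forall>k l y z.
        (\<sigma>, k, y) \<in> ?\<rho> p x \<and> (\<tau>, l, z) \<in> ?\<rho> q y \<or> (\<tau>, k, y) \<in> ?\<rho> p x \<and> (\<sigma>, l, z) \<in> ?\<rho> q y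
        \<longrightarrow> (\<sigma>, k \<otimes>\<^bsub>trivial_monoid\<^esub> l, z) \<in> ?\<rho> (p \<otimes>\<^bsub>N \<times>\<times> M\<^esub> q) x) \<longleftrightarrow>
     (\<forall>m\<in>carrier N. \<forall>n\<in>carrier N. \<forall>x\<in>X. \<forall>\<sigma>\<in>Sigma_tau \<Sigma>. \<forall>k l y z.
        (\<sigma>, k, y) \<in> \<pi> m x \<and> (\<tau>, l, z) \<in> \<pi> n y \<or> (\<tau>, k, y) \<in> \<pi> m x \<and> (\<sigma>, l, z) \<in> \<pi> n y
        \<longrightarrow> (\<sigma>, k \<otimes>\<^bsub>M\<^esub> l, z) \<in> \<pi> (m \<otimes>\<^bsub>N\<^esub> n) x)" (is "?L \<longleftrightarrow> ?R")
  proof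
    assume L: ?L
    show ?R
    proof (intro ballI allI impI)
      fix m n x \<sigma> k l y z
      assume m: "m \<in> carrier N" and n: "n \<in> carrier N" and x: "x \<in> X"
        and s: "\<sigma> \<in> Sigma_tau \<Sigma>"
        and h: "(\<sigma>, k, y) \<in> \<pi> m x \<and> (\<tau>, l, z) \<in> \<pi> n y \<or> (\<tau>, k, y) \<in> \<pi> m x \<and> (\<sigma>, l, z) \<in> \<pi> n y"
      \<comment> \<open>The labels \<open>k\<close> and \<open>l\<close> can become indices only
        once they are known to lie in the carrier. For \<open>l\<close> this needs
        \<open>y \<in> X\<close> first, since the second step starts at \<open>y\<close>.\<close>
      have y: "y \<in> X" and k: "k \<in> carrier M" using h D[OF m x] by blast+
      have l: "l \<in> carrier M" using h D[OF n y] by blast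
      \<comment> \<open>This is \<open>?L\<close> at the indices \<open>(m, k)\<close> and
        \<open>(n, l)\<close>, with both remaining labels trivial.\<close>
      have "(\<sigma>, () \<otimes>\<^bsub>trivial_monoid\<^esub> (), z) \<in> ?\<rho> ((m, k) \<otimes>\<^bsub>N \<times>\<times> M\<^esub> (n, l)) x"
        using L m n x s h k l step[OF m k x] step[OF n l y] by (simp only: carrier_DirProd) blast
      then show "(\<sigma>, k \<otimes>\<^bsub>M\<^esub> l, z) \<in> \<pi> (m \<otimes>\<^bsub>N\<^esub> n) x"
        using m n k l x by (simp add: labels_to_index_iff)
    qed
  next
    assume R: ?R
    show ?L
    proof (intro ballI allI impI)
      fix p q x \<sigma> y z and k l :: unit
      assume "p \<in> carrier (N \<times>\<times> M)" "q \<in> carrier (N \<times>\<times> M)" and x: "x \<in> X"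
        and s: "\<sigma> \<in> Sigma_tau \<Sigma>"
        and h: "(\<sigma>, k, y) \<in> ?\<rho> p x \<and> (\<tau>, l, z) \<in> ?\<rho> q y \<or> (\<tau>, k, y) \<in> ?\<rho> p x \<and> (\<sigma>, l, z) \<in> ?\<rho> q y"
      then obtain m i n j where p: "p = (m, i)" "m \<in> carrier N" "i \<in> carrier M"
        and q: "q = (n, j)" "n \<in> carrier N" "j \<in> carrier M" by auto
      have y: "y \<in> X" using h D\<rho> p x by blast
      \<comment> \<open>The labels fed to \<open>?R\<close> are the second components
        \<open>i\<close> and \<open>j\<close> of the indices; the labels \<open>k\<close> and
        \<open>l\<close> are trivial.\<close>
      have "(\<sigma>, i \<otimes>\<^bsub>M\<^esub> j, z) \<in> \<pi> (m \<otimes>\<^bsub>N\<^esub> n) x"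
        using h R p(2,3) q(2,3) x s unfolding p(1) q(1)
          labels_to_index_iff[OF p(2,3) x] labels_to_index_iff[OF q(2,3) y] by blast
      then show "(\<sigma>, k \<otimes>\<^bsub>trivial_monoid\<^esub> l, z) \<in> ?\<rho> (p \<otimes>\<^bsub>N \<times>\<times> M\<^esub> q) x"
        using p q x by (simp add: labels_to_index_iff)
    qed
  qed
  then show ?thesis
    unfolding lax_functors_Kl_iff using \<pi> labels_to_index_in[OF \<pi>] unit by auto
qed

text \<open>A simulation keeps both index and label, so it does not matter on which side the label
  is recorded. Quantifying over indices in \<open>carrier M\<close> covers all labels, because no
  others occur in \<pi>.\<close>

lemma labels_to_index_oplax:
  assumes M: "monoid M"
    and \<pi>: "\<pi> \<in> carrier N \<rightarrow>\<^sub>E (X \<rightarrow>\<^sub>E PSM \<Sigma> M X)" and \<pi>': "\<pi>' \<in> carrier N \<rightarrow>\<^sub>E (Y \<rightarrow>\<^sub>E PSM \<Sigma> M Y)"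
  shows "oplax_transformations (N \<times>\<times> M) (Kl \<Sigma> trivial_monoid)
      (X, labels_to_index N M X \<pi>) (Y, labels_to_index N M Y \<pi>')
    = oplax_transformations N (Kl \<Sigma> M) (X, \<pi>) (Y, \<pi>')"
proof -
  have triv: "monoid trivial_monoid" by (simp add: group.is_monoid)
  have "(\<forall>p\<in>carrier (N \<times>\<times> M). \<forall>x\<in>X. \<forall>\<sigma> u y. (\<sigma>, u, y) \<in> labels_to_index N M X \<pi> p x
        \<longrightarrow> (\<sigma>, u, f y) \<in> labels_to_index N M Y \<pi>' p (f x)) \<longleftrightarrow>
      (\<forall>n\<in>carrier N. \<forall>x\<in>X. \<forall>\<sigma> m y. (\<sigma>, m, y) \<in> \<pi> n x \<longrightarrow> (\<sigma>, m, f y) \<in> \<pi>' n (f x))"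
    if f: "f \<in> X \<rightarrow>\<^sub>E Y" for f
    using kleisli_hom_D(2)[OF PiE_mem[OF \<pi>]] PiE_mem[OF f]
    by (auto simp: labels_to_index_iff)
  then show ?thesis
    unfolding set_eq_iff oplax_transformations_Kl_iff[OF M \<pi> \<pi>']
      oplax_transformations_Kl_iff[OF triv labels_to_index_in[OF \<pi>] labels_to_index_in[OF \<pi>']]
    by blast
qed

theorem theorem3p11:
  fixes \<Sigma> :: "'s set"
    and M :: "('m, 'b) monoid_scheme"
    and M' :: "('n, 'c) monoid_scheme"
  assumes "monoid M" and "monoid M'"
  shows "lax_functor_category M' (Kl \<Sigma> M :: ('x, ('x, 's, 'm) kleisli_map) ord_category)
    \<cong>\<^sub>C lax_functor_category (M' \<times>\<times> M)
         (Kl \<Sigma> trivial_monoid :: ('x, ('x, 's, unit) kleisli_map) ord_category)"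
proof (rule lax_functor_category_isoI[where F = "labels_to_index M' M" and G = "index_to_labels M' M"])
  note in1 = lax_functors_Kl_iff[THEN iffD1, THEN conjunct1]
  show "category (lax_functor_category M' (Kl \<Sigma> M))"
    by (intro category_lax_functor_category_Kl assms)
  show "category (lax_functor_category (M' \<times>\<times> M) (Kl \<Sigma> trivial_monoid))"
    by (intro category_lax_functor_category_Kl DirProd_monoid assms) (simp add: group.is_monoid)
  fix X Y :: "'x set" and \<pi> \<pi>'
  assume A: "(X, \<pi>) \<in> lax_functors M' (Kl \<Sigma> M)"
  then show "(X, labels_to_index M' M X \<pi>) \<in> lax_functors (M' \<times>\<times> M) (Kl \<Sigma> trivial_monoid)"
    by (simp add: labels_to_index_lax_iff[OF assms in1])
  show "index_to_labels M' M X (labels_to_index M' M X \<pi>) = \<pi>"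
    by (rule index_to_labels_labels_to_index[OF in1[OF A]])
  assume "(Y, \<pi>') \<in> lax_functors M' (Kl \<Sigma> M)"
  then show "oplax_transformations (M' \<times>\<times> M) (Kl \<Sigma> trivial_monoid)
      (X, labels_to_index M' M X \<pi>) (Y, labels_to_index M' M Y \<pi>')
    = oplax_transformations M' (Kl \<Sigma> M) (X, \<pi>) (Y, \<pi>')"
    by (rule labels_to_index_oplax[OF assms(1) in1[OF A] in1])
next
  fix X :: "'x set" and \<rho>
  assume A: "(X, \<rho>) \<in> lax_functors (M' \<times>\<times> M) (Kl \<Sigma> trivial_monoid)"
  note \<rho> = lax_functors_Kl_iff[THEN iffD1, THEN conjunct1, OF A]
  show inv: "labels_to_index M' M X (index_to_labels M' M X \<rho>) = \<rho>"
    by (rule labels_to_index_index_to_labels[OF \<rho>])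
  \<comment> \<open>The equivalence for lax functors is read from right to left in terms of \<rho>:
    by \<open>inv\<close>, the family that it sees on the product side is \<rho> itself, which is
    lax by assumption.\<close>
  show "(X, index_to_labels M' M X \<rho>) \<in> lax_functors M' (Kl \<Sigma> M)"
    using A labels_to_index_lax_iff[OF assms index_to_labels_in[OF \<rho>]] by (simp add: inv)
qed

end
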